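(* Let $0<\gamma<1$. Assume that $g_\theta(y)$ is $\gamma$-weakly convex and continuously differentiable in $y$, and $L$-smooth in $\theta$, and that for each $\theta$ and $z$ the point $y_\theta^\star(z)$ is the unique minimizer of $$\min_{y\in\mathbb{R}^d}\Big\{\tfrac12\|y-z\|^2+g_\theta(y)\Big\}.$$ Then the gradient of the loss $$\mathcal{L}(\theta)=\mathbb{E}_{x\sim\mu}[g_\theta(x)]-\mathbb{E}_{z\sim\nu}\Big[\tfrac12\|y_\theta^\star(z)-z\|^2+g_\theta\big(y_\theta^\star(z)\big)\Big]$$ is given by $$\frac{d\mathcal{L}}{d\theta}=\mathbb{E}_{x\sim\mu}\Big[\frac{\partial g_\theta(x)}{\partial\theta}\Big]-\mathbb{E}_{z\sim\nu}\Big[\frac{\partial g_\theta}{\partial\theta}\big(y_\theta^\star(z)\big)\Big],$$ where in the last term $\partial g_\theta/\partial\theta$ is the partial derivative with respect to $\theta$ at fixed argument $y$, evaluated at $y=y_\theta^\star(z)$.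
   Context: $\mu,\nu$ are probability measures on $\mathbb{R}^d$ with finite second moments. $g:\mathbb{R}^p\times\mathbb{R}^d\to\mathbb{R}$, $(\theta,y)\mapsto g_\theta(y)$, is a parameterized scalar potential, with parameter $\theta\in\mathbb{R}^p$. "$\gamma$-weakly convex in $y$" means that $y\mapsto g_\theta(y)+\frac{\gamma}{2}\|y\|^2$ is convex for every $\theta$. "$L$-smooth in $\theta$" means that for each $y$ the map $\theta\mapsto g_\theta(y)$ is differentiable with $L$-Lipschitz gradient. The expectations defining $\mathcal{L}(\theta)$ are understood to be finite for every $\theta$. *)

theory Defs
  imports "HOL-Probability.Probability"
begin

definition gradient :: "('a::real_inner \<Rightarrow> real) \<Rightarrow> 'a \<Rightarrow> 'a" where
  "gradient f x = (THE D. GDERIV f x :> D)"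

lemma gradient_eqI:
  assumes "GDERIV f x :> D"
  shows "gradient f x = D"
  unfolding gradient_def
proof (rule the_equality)
  show "GDERIV f x :> D" by (fact assms)
  fix D' assume "GDERIV f x :> D'"
  then have "(\<lambda>h. inner h D') = (\<lambda>h. inner h D)"
    using assms unfolding gderiv_def by (rule has_derivative_unique)
  then have "inner h D' = inner h D" for h by (rule fun_cong)
  then have "inner (D' - D) (D' - D) = 0" by (simp add: inner_diff_right)
  then show "D' = D" by simp
qed

lemma GDERIV_gradient:
  fixes f :: "'a::euclidean_space \<Rightarrow> real"
  assumes "f differentiable (at x)"
  shows "GDERIV f x :> gradient f x"
proof -
  from assms obtain f' where f': "(f has_derivative f') (at x)"
    unfolding differentiable_def by blast
  then have lin: "linear f'" by (rule has_derivative_linear)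
  have "f' = (\<lambda>h. inner h (adjoint f' 1))"
  proof
    fix h show "f' h = inner h (adjoint f' 1)"
      using adjoint_works[OF lin, of h 1] by simp
  qed
  with f' have "GDERIV f x :> adjoint f' 1"
    unfolding gderiv_def by metis
  with gradient_eqI[OF this] show ?thesis by simp
qed

definition weakly_convex :: "real \<Rightarrow> ('a::real_inner \<Rightarrow> real) \<Rightarrow> bool" where
  "weakly_convex \<gamma> f \<longleftrightarrow> convex_on UNIV (\<lambda>y. f y + \<gamma> / 2 * (norm y)\<^sup>2)"

definition cont_differentiable :: "('a::real_inner \<Rightarrow> real) \<Rightarrow> bool" where
  "cont_differentiable f \<longleftrightarrow> f differentiable_on UNIV \<and> continuous_on UNIV (gradient f)"

definition smooth_fun :: "real \<Rightarrow> ('a::real_inner \<Rightarrow> real) \<Rightarrow> bool" where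
  "smooth_fun L f \<longleftrightarrow> f differentiable_on UNIV \<and> L-lipschitz_on UNIV (gradient f)"

definition prox_objective :: "('a::real_inner \<Rightarrow> real) \<Rightarrow> 'a \<Rightarrow> 'a \<Rightarrow> real" where
  "prox_objective f z y = 1 / 2 * (norm (y - z))\<^sup>2 + f y"

definition unique_minimizer :: "('a \<Rightarrow> real) \<Rightarrow> 'a \<Rightarrow> bool" where
  "unique_minimizer F y \<longleftrightarrow> (\<forall>y'. is_arg_min F (\<lambda>_. True) y' \<longleftrightarrow> y' = y)"

definition prob_finite_second_moment :: "('a::euclidean_space) measure \<Rightarrow> bool" where
  "prob_finite_second_moment M \<longleftrightarrow>
     prob_space M \<and> sets M = sets borel \<and> integrable M (\<lambda>x. (norm x)\<^sup>2)"

definition loss ::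
  "'d measure \<Rightarrow> 'd measure \<Rightarrow> ('p \<Rightarrow> 'd \<Rightarrow> real) \<Rightarrow> ('p \<Rightarrow> 'd \<Rightarrow> 'd::real_inner) \<Rightarrow> 'p \<Rightarrow> real" where
  "loss \<mu> \<nu> g ystar \<theta> =
     (LINT x|\<mu>. g \<theta> x) - (LINT z|\<nu>. prox_objective (g \<theta>) z (ystar \<theta> z))"

end

theory Submission
  imports Defs
begin

text \<open>
  The two expectations are handled alike. A function whose first-order Taylor remainder is at most
  \<open>L / 2 * (norm h)\<^sup>2\<close> is, up to the quadratic \<open>L / 2 * (norm \<theta>)\<^sup>2\<close>, concave; this applies to
  \<open>g\<close> and, comparing with the minimizer at the old parameter, to the optimal value \<open>V\<close> of the
  proximal problem. For convex integrands differentiation under the integral needs no further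
  hypothesis: the remainder is convex, nonnegative and zero at zero, so for small \<open>h\<close> it is at most
  \<open>norm h\<close> times the sum of its values at the signed basis vectors, which is an integrable bound.
  Measurability and integrability of the gradient come from difference quotients in \<open>\<theta>\<close>, so no
  measurability of \<open>ystar\<close> in \<open>z\<close> is required.

  The pointwise derivative of \<open>V\<close> is Danskin's formula. The bound from below uses the minimizer at
  the new parameter, which tends to the old one by convexity, and the continuity in \<open>y\<close> of the
  \<open>\<theta>\<close>-gradient, a uniform limit of difference quotients.
\<close>

section \<open>First-order inequalities for convex functions\<close>

text \<open>Apply the subgradient inequality at the intermediate point towards both ends and
  average: the linear terms cancel. The field \<open>v\<close> need not be a gradient.\<close>

lemma convex_on_of_subgradient:
  fixes f :: "'a::real_inner \<Rightarrow> real"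
  assumes "\<And>x y. f x + inner (y - x) (v x) \<le> f y"
  shows "convex_on UNIV f"
proof (rule convex_onI)
  fix t :: real and x y :: 'a
  assume t: "0 < t" "t < 1"
  define w where "w = (1 - t) *\<^sub>R x + t *\<^sub>R y"
  have "(1 - t) * (f w + inner (x - w) (v w)) + t * (f w + inner (y - w) (v w))
      \<le> (1 - t) * f x + t * f y"
    using t by (intro add_mono mult_left_mono assms) auto
  moreover have "(1 - t) * inner (x - w) (v w) + t * inner (y - w) (v w) = 0"
    unfolding w_def by (simp add: algebra_simps inner_add_left inner_diff_left)
  ultimately show "f ((1 - t) *\<^sub>R x + t *\<^sub>R y) \<le> (1 - t) * f x + t * f y"
    unfolding w_def[symmetric] by (simp add: algebra_simps)
qed simp

lemma gderiv_along_line: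
  fixes f :: "'a::real_inner \<Rightarrow> real"
  assumes "GDERIV f (x + t *\<^sub>R h) :> D"
  shows "((\<lambda>t. f (x + t *\<^sub>R h)) has_field_derivative inner h D) (at t)"
proof -
  have "((\<lambda>t. f (x + t *\<^sub>R h)) has_derivative (\<lambda>s. inner (s *\<^sub>R h) D)) (at t)"
    by (rule has_derivative_compose[where g=f and f="\<lambda>t. x + t *\<^sub>R h"])
      (use assms in \<open>auto intro!: derivative_eq_intros simp: gderiv_def\<close>)
  then show ?thesis
    by (rule has_derivative_imp_has_field_derivative) simp
qed

text \<open>By convexity the secant slopes on the ray are at most the slope over the whole step
  \<open>h\<close>; let the step length tend to zero from the right.\<close>

lemma convex_on_gderiv_le:
  fixes f :: "'a::real_inner \<Rightarrow> real"
  assumes conv: "convex_on UNIV f" and D: "GDERIV f x :> D"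
  shows "f x + inner h D \<le> f (x + h)"
proof -
  have "((\<lambda>t. f (x + t *\<^sub>R h)) has_field_derivative inner h D) (at 0)"
    using D by (intro gderiv_along_line) simp
  then have lim: "((\<lambda>t. (f (x + t *\<^sub>R h) - f x) / t) \<longlongrightarrow> inner h D) (at_right 0)"
    unfolding has_field_derivative_iff by (auto intro: tendsto_within_subset)
  have "\<forall>\<^sub>F t in at_right (0::real). t < 1"
    by (auto simp: eventually_at_right_field intro: exI[of _ 1])
  then have "\<forall>\<^sub>F t in at_right 0. (f (x + t *\<^sub>R h) - f x) / t \<le> f (x + h) - f x"
    using eventually_at_right_less
  proof eventually_elim
    case (elim t)
    have "f ((1 - t) *\<^sub>R x + t *\<^sub>R (x + h)) \<le> (1 - t) * f x + t * f (x + h)"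
      using conv elim by (intro convex_onD) auto
    moreover have "(1 - t) *\<^sub>R x + t *\<^sub>R (x + h) = x + t *\<^sub>R h"
      by (simp add: algebra_simps)
    ultimately show ?case using elim by (simp add: field_simps)
  qed
  then have "inner h D \<le> f (x + h) - f x"
    using lim by (intro tendsto_upperbound) auto
  then show ?thesis by simp
qed

text \<open>Jensen's inequality along the coordinate axes. Apart from the factor
  \<open>norm h\<close> the bound does not involve \<open>h\<close>, so it can serve as a dominating
  function for the quotients \<open>r h / norm h\<close>.\<close>

lemma convex_on_le_coordinates:
  fixes r :: "'a::euclidean_space \<Rightarrow> real"
  assumes conv: "convex_on UNIV r" and nonneg: "\<And>h. 0 \<le> r h" and zero: "r 0 = 0"
    and small: "DIM('a) * norm h \<le> 1"
  shows "r h \<le> norm h * (\<Sum>b\<in>Basis. r b + r (- b))"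
proof -
  let ?m = "real DIM('a)"
  have scale: "r (s *\<^sub>R b) \<le> \<bar>s\<bar> * (r b + r (- b))" if s: "\<bar>s\<bar> \<le> 1" for s b
  proof -
    \<comment> \<open>The sign of \<open>s\<close> moves into the vector, so that
      \<open>s *\<^sub>R b\<close> lies on the segment from 0 to \<open>c\<close>.\<close>
    define c where "c = (if s < 0 then - b else b)"
    have "s *\<^sub>R b = (1 - \<bar>s\<bar>) *\<^sub>R 0 + \<bar>s\<bar> *\<^sub>R c"
      by (simp add: c_def)
    then have "r (s *\<^sub>R b) \<le> (1 - \<bar>s\<bar>) * r 0 + \<bar>s\<bar> * r c"
      using convex_onD[OF conv, of "\<bar>s\<bar>" 0 c] s by simp
    also have "\<dots> \<le> \<bar>s\<bar> * (r b + r (- b))"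
      using nonneg[of b] nonneg[of "- b"] zero
      by (auto simp: c_def intro!: mult_left_mono)
    finally show ?thesis .
  qed
  \<comment> \<open>Read \<open>h\<close> as an average of \<open>DIM('a)\<close> vectors on the
    axes; \<open>small\<close> keeps each within the segment from \<open>- b\<close> to
    \<open>b\<close>.\<close>
  have "h = (\<Sum>b\<in>Basis. (1 / ?m) *\<^sub>R ((?m * inner h b) *\<^sub>R b))"
    by (simp add: euclidean_representation)
  then have "r h = r (\<Sum>b\<in>Basis. (1 / ?m) *\<^sub>R ((?m * inner h b) *\<^sub>R b))" by simp
  also have "\<dots> \<le> (\<Sum>b\<in>Basis. (1 / ?m) * r ((?m * inner h b) *\<^sub>R b))"
    by (rule convex_on_sum[OF _ _ conv]) (auto)
  also have "\<dots> \<le> (\<Sum>b\<in>Basis. norm h * (r b + r (- b)))"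
  proof (rule sum_mono)
    fix b :: 'a assume b: "b \<in> Basis"
    have hb: "\<bar>inner h b\<bar> \<le> norm h" using b by (rule Basis_le_norm)
    have "?m * \<bar>inner h b\<bar> \<le> 1"
      using mult_left_mono[OF hb, of ?m] small by linarith
    then have "\<bar>?m * inner h b\<bar> \<le> 1" by (simp add: abs_mult)
    from scale[OF this, of b]
    have "(1 / ?m) * r ((?m * inner h b) *\<^sub>R b) \<le> (1 / ?m) * (\<bar>?m * inner h b\<bar> * (r b + r (- b)))"
      by (intro mult_left_mono) auto
    also have "\<dots> = \<bar>inner h b\<bar> * (r b + r (- b))" by (simp add: abs_mult)
    also have "\<dots> \<le> norm h * (r b + r (- b))"
      using hb nonneg[of b] nonneg[of "- b"] by (intro mult_right_mono) auto
    finally show "(1 / ?m) * r ((?m * inner h b) *\<^sub>R b) \<le> norm h * (r b + r (- b))" .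
  qed
  finally show ?thesis by (simp add: sum_distrib_left)
qed

section \<open>Differentiation under the integral for convex integrands\<close>

text \<open>The gradient inequality for \<open>h\<close> and \<open>- h\<close> bounds
  \<open>inner h (G z)\<close> from both sides by integrable increments. Integrability of
  \<open>G\<close> is then assembled from its coordinates.\<close>

lemma integrable_gderiv_convex:
  fixes f :: "'a::euclidean_space \<Rightarrow> 'z \<Rightarrow> real"
  assumes int: "\<And>x. integrable M (f x)"
    and conv: "\<And>z. convex_on UNIV (\<lambda>x. f x z)"
    and D: "\<And>z. GDERIV (\<lambda>x. f x z) x :> G z"
  shows "integrable M G"
proof -
  have lower: "inner h (G z) \<le> f (x + h) z - f x z" for h z
    using convex_on_gderiv_le[OF conv D, of z h] by simp
  have "integrable M (\<lambda>z. inner h (G z))" for h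
  proof (rule Bochner_Integration.integrable_bound)
    show "integrable M (\<lambda>z. \<bar>f (x + h) z - f x z\<bar> + \<bar>f (x + - h) z - f x z\<bar>)"
      using int by auto
    have "((\<lambda>t. f (x + t *\<^sub>R h) z) has_field_derivative inner h (G z)) (at 0)" for z
      using D[of z] by (intro gderiv_along_line) simp
    then have "((\<lambda>t. (f (x + t *\<^sub>R h) z - f x z) / t) \<longlongrightarrow> inner h (G z)) (at 0)" for z
      unfolding has_field_derivative_iff by auto
    \<comment> \<open>Positive step lengths are needed: the limit is taken along
      \<open>at 0\<close>, which excludes 0 itself.\<close>
    moreover have "filterlim (\<lambda>n. inverse (real (Suc n))) (at 0) sequentially"
      using LIMSEQ_inverse_real_of_nat by (auto simp: filterlim_at)
    ultimately have "(\<lambda>n. (f (x + inverse (real (Suc n)) *\<^sub>R h) z - f x z) / inverse (real (Suc n)))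
        \<longlonglongrightarrow> inner h (G z)" for z
      by (rule filterlim_compose)
    then show "(\<lambda>z. inner h (G z)) \<in> borel_measurable M"
      by (rule borel_measurable_LIMSEQ_real)
        (intro borel_measurable_divide borel_measurable_diff
          borel_measurable_integrable[OF int] borel_measurable_const)
    show "AE z in M. norm (inner h (G z)) \<le> norm (\<bar>f (x + h) z - f x z\<bar> + \<bar>f (x + - h) z - f x z\<bar>)"
    proof (rule AE_I2)
      fix z
      show "norm (inner h (G z)) \<le> norm (\<bar>f (x + h) z - f x z\<bar> + \<bar>f (x + - h) z - f x z\<bar>)"
        using lower[of h z] lower[of "- h" z] by (auto simp: abs_if)
    qed
  qed
  then have "integrable M (\<lambda>z. \<Sum>b\<in>Basis. inner b (G z) *\<^sub>R b)"
    by (intro Bochner_Integration.integrable_sum integrable_scaleR_left) auto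
  then show ?thesis
    by (simp add: euclidean_representation inner_commute[of _ "G _"])
qed

lemma gderiv_integral_convex:
  fixes f :: "'a::euclidean_space \<Rightarrow> 'z \<Rightarrow> real"
  assumes int: "\<And>x. integrable M (f x)"
    and conv: "\<And>z. convex_on UNIV (\<lambda>x. f x z)"
    and D: "\<And>z. GDERIV (\<lambda>x. f x z) x :> G z"
  shows "GDERIV (\<lambda>x. LINT z|M. f x z) x :> (LINT z|M. G z)"
proof -
  have intG: "integrable M G" using assms by (rule integrable_gderiv_convex)
  define r where "r h z = f (x + h) z - f x z - inner h (G z)" for h z
  have r_int: "integrable M (r h)" for h
    unfolding r_def using int intG by auto
  have r_nonneg: "0 \<le> r h z" for h z
    using convex_on_gderiv_le[OF conv D, of z h] by (simp add: r_def)
  have r_conv: "convex_on UNIV (\<lambda>h. r h z)" for z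
  proof (rule convex_onI)
    fix t :: real and u v :: 'a
    assume t: "0 < t" "t < 1"
    have "f ((1 - t) *\<^sub>R (x + u) + t *\<^sub>R (x + v)) z \<le> (1 - t) * f (x + u) z + t * f (x + v) z"
      using t by (intro convex_onD[OF conv]) auto
    moreover have "(1 - t) *\<^sub>R (x + u) + t *\<^sub>R (x + v) = x + ((1 - t) *\<^sub>R u + t *\<^sub>R v)"
      by (simp add: algebra_simps)
    ultimately show "r ((1 - t) *\<^sub>R u + t *\<^sub>R v) z \<le> (1 - t) * r u z + t * r v z"
      unfolding r_def by (simp add: algebra_simps inner_add_left inner_diff_left)
  qed simp
  \<comment> \<open>This is the dominating function for \<open>r h z / norm h\<close> at all small
    nonzero \<open>h\<close>.\<close>
  define w where "w z = (\<Sum>b\<in>Basis. r b z + r (- b) z)" for z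
  have w_int: "integrable M w"
    unfolding w_def using r_int by auto
  have r_lim: "((\<lambda>h. r h z / norm h) \<longlongrightarrow> 0) (at 0)" for z
  proof -
    have "((\<lambda>h. norm (r h z) / norm h) \<longlongrightarrow> 0) (at 0)"
      using D[of z] unfolding gderiv_def has_derivative_at r_def by simp
    then show ?thesis by (simp add: r_nonneg)
  qed
  \<comment> \<open>Dominated convergence is a statement about sequences, so the limit is tested
    along arbitrary sequences of nonzero vectors.\<close>
  have "((\<lambda>h. (LINT z|M. r h z) / norm h) \<longlongrightarrow> 0) (at 0)"
    unfolding tendsto_at_iff_sequentially
  proof (intro allI impI)
    fix X :: "nat \<Rightarrow> 'a"
    assume X: "\<forall>i. X i \<in> UNIV - {0}" "X \<longlonglongrightarrow> 0"
    have "(\<lambda>n. DIM('a) * norm (X n)) \<longlonglongrightarrow> DIM('a) * norm (0::'a)"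
      by (intro tendsto_intros X)
    then have small: "\<forall>\<^sub>F n in sequentially. DIM('a) * norm (X n) < 1"
      by (rule order_tendstoD) simp
    then obtain N where N: "\<And>n. n \<ge> N \<Longrightarrow> DIM('a) * norm (X n) < 1"
      unfolding eventually_sequentially by blast
    \<comment> \<open>Shifting by \<open>N\<close> makes the domination hold for every index, not
      just eventually.\<close>
    have "(\<lambda>n. LINT z|M. r (X (n + N)) z / norm (X (n + N))) \<longlonglongrightarrow> (LINT z|M. 0)"
    proof (rule integral_dominated_convergence[where w=w])
      show "(\<lambda>z. r (X (n + N)) z / norm (X (n + N))) \<in> borel_measurable M" for n
        using r_int by (intro borel_measurable_divide) auto
      show "AE z in M. (\<lambda>n. r (X (n + N)) z / norm (X (n + N))) \<longlonglongrightarrow> 0"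
      proof (rule AE_I2)
        fix z
        have "(\<lambda>n. r (X n) z / norm (X n)) \<longlonglongrightarrow> 0"
          using r_lim[of z] X unfolding tendsto_at_iff_sequentially comp_def by blast
        then show "(\<lambda>n. r (X (n + N)) z / norm (X (n + N))) \<longlonglongrightarrow> 0"
          by (rule LIMSEQ_ignore_initial_segment)
      qed
      show "AE z in M. norm (r (X (n + N)) z / norm (X (n + N))) \<le> w z" for n
      proof (rule AE_I2)
        fix z
        have "r (X (n + N)) z \<le> norm (X (n + N)) * w z"
          unfolding w_def
          by (rule convex_on_le_coordinates[OF r_conv])
            (use r_nonneg N[of "n + N"] in \<open>auto simp: r_def intro: less_imp_le\<close>)
        moreover have "norm (X (n + N)) > 0" using X by simp
        ultimately show "norm (r (X (n + N)) z / norm (X (n + N))) \<le> w z"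
          using r_nonneg by (simp add: field_simps)
      qed
    qed (use w_int in auto)
    then have "(\<lambda>n. (LINT z|M. r (X (n + N)) z) / norm (X (n + N))) \<longlonglongrightarrow> 0"
      by simp
    then have "(\<lambda>n. (LINT z|M. r (X n) z) / norm (X n)) \<longlonglongrightarrow> 0"
      by (rule LIMSEQ_offset)
    then show "((\<lambda>h. (LINT z|M. r h z) / norm h) \<circ> X) \<longlonglongrightarrow> 0"
      by (simp add: comp_def)
  qed
  moreover have "(LINT z|M. r h z) =
      (LINT z|M. f (x + h) z) - (LINT z|M. f x z) - inner h (LINT z|M. G z)" for h
    unfolding r_def using int intG by simp
  \<comment> \<open>Nonnegativity lets the norm required by the definition of the derivative be
    inserted.\<close>
  moreover have "0 \<le> (LINT z|M. r h z)" for h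
    by (simp add: r_nonneg)
  ultimately have "((\<lambda>h. norm ((LINT z|M. f (x + h) z) - (LINT z|M. f x z)
      - inner h (LINT z|M. G z)) / norm h) \<longlongrightarrow> 0) (at 0)"
    by simp
  then show ?thesis
    unfolding gderiv_def has_derivative_at by (simp add: bounded_linear_inner_left)
qed

section \<open>Quadratic Taylor bounds and semiconcave integrands\<close>

lemma smooth_fun_gderiv:
  fixes f :: "'a::euclidean_space \<Rightarrow> real"
  assumes "smooth_fun L f"
  shows "GDERIV f x :> gradient f x"
  using assms unfolding smooth_fun_def
  by (intro GDERIV_gradient) (simp add: differentiable_on_def)

lemma smooth_fun_taylor:
  fixes f :: "'a::euclidean_space \<Rightarrow> real"
  assumes "smooth_fun L f"
  shows "\<bar>f y - f x - inner (y - x) (gradient f x)\<bar> \<le> L / 2 * (norm (y - x))\<^sup>2"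
proof -
  define h where "h = y - x"
  have lip: "norm (gradient f u - gradient f v) \<le> L * norm (u - v)" for u v
    using assms lipschitz_onD[of L UNIV "gradient f" u v]
    by (simp add: smooth_fun_def dist_norm)
  have der: "((\<lambda>t. f (x + t *\<^sub>R h)) has_field_derivative inner h (gradient f (x + t *\<^sub>R h))) (at t)" for t
    by (rule gderiv_along_line[OF smooth_fun_gderiv[OF assms]])
  have slope: "\<bar>inner h (gradient f (x + t *\<^sub>R h)) - inner h (gradient f x)\<bar> \<le> L * t * (norm h)\<^sup>2"
    if "0 \<le> t" for t
  proof -
    have "\<bar>inner h (gradient f (x + t *\<^sub>R h) - gradient f x)\<bar>
        \<le> norm h * norm (gradient f (x + t *\<^sub>R h) - gradient f x)"
      by (rule Cauchy_Schwarz_ineq2)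
    also have "\<dots> \<le> norm h * (L * norm (t *\<^sub>R h))"
      using lip[of "x + t *\<^sub>R h" x] by (intro mult_left_mono) auto
    finally show ?thesis using that by (simp add: inner_diff_right power2_eq_square mult_ac)
  qed
  \<comment> \<open>The sign \<open>s\<close> treats the upper and the lower bound together. The
    expression is an auxiliary function of \<open>t\<close> at 1 and at 0; \<open>slope\<close>
    makes its derivative nonpositive in between.\<close>
  have "s * (f (x + 1 *\<^sub>R h) - 1 * inner h (gradient f x)) - L / 2 * 1\<^sup>2 * (norm h)\<^sup>2
      \<le> s * (f (x + 0 *\<^sub>R h) - 0 * inner h (gradient f x)) - L / 2 * 0\<^sup>2 * (norm h)\<^sup>2"
    if s: "s = 1 \<or> s = - 1" for s :: real
  proof (rule DERIV_nonpos_imp_nonincreasing[where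
        f="\<lambda>t. s * (f (x + t *\<^sub>R h) - t * inner h (gradient f x)) - L / 2 * t\<^sup>2 * (norm h)\<^sup>2"])
    fix t :: real assume "0 \<le> t" "t \<le> 1"
    then show "\<exists>d. ((\<lambda>t. s * (f (x + t *\<^sub>R h) - t * inner h (gradient f x)) - L / 2 * t\<^sup>2 * (norm h)\<^sup>2)
        has_real_derivative d) (at t) \<and> d \<le> 0"
      using slope[of t] s
      by (intro exI[of _ "s * (inner h (gradient f (x + t *\<^sub>R h)) - inner h (gradient f x)) - L * t * (norm h)\<^sup>2"])
        (auto intro!: derivative_eq_intros der)
  qed simp
  from this[of 1] this[of "-1"] show ?thesis
    unfolding h_def by (simp add: abs_if)
qed

lemma norm_sq_expand:
  fixes x h :: "'a::real_inner"
  shows "(norm (x + h))\<^sup>2 = (norm x)\<^sup>2 + 2 * inner h x + (norm h)\<^sup>2"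
  by (simp add: power2_norm_eq_inner inner_add_left inner_add_right inner_commute)

text \<open>The first-order remainder of \<open>L / 2 * (norm x)\<^sup>2\<close> is exactly
  \<open>L / 2 * (norm (y - x))\<^sup>2\<close>, so the hypothesis says that
  \<open>L *\<^sub>R x - v x\<close> is a subgradient.\<close>

lemma convex_on_semiconcave:
  fixes f :: "'a::real_inner \<Rightarrow> real"
  assumes "\<And>x y. f y - f x - inner (y - x) (v x) \<le> L / 2 * (norm (y - x))\<^sup>2"
  shows "convex_on UNIV (\<lambda>x. L / 2 * (norm x)\<^sup>2 - f x)"
proof (rule convex_on_of_subgradient[where v="\<lambda>x. L *\<^sub>R x - v x"])
  fix x y :: 'a
  show "L / 2 * (norm x)\<^sup>2 - f x + inner (y - x) (L *\<^sub>R x - v x) \<le> L / 2 * (norm y)\<^sup>2 - f y"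
  proof -
    define h where "h = y - x"
    have y: "y = x + h" by (simp add: h_def)
    show ?thesis
      using assms[of "x + h" x] unfolding y norm_sq_expand
      by (simp add: inner_diff_right algebra_simps)
  qed
qed

text \<open>Reduces to the convex case by passing to the quadratic minus \<open>f\<close>. The
  quadratic is constant in \<open>z\<close>, hence integrable over a finite measure.\<close>

lemma gderiv_integral_semiconcave:
  fixes f :: "'a::euclidean_space \<Rightarrow> 'z \<Rightarrow> real"
  assumes "finite_measure M"
    and int: "\<And>x. integrable M (f x)"
    and semi: "\<And>x y z. f y z - f x z - inner (y - x) (G x z) \<le> L / 2 * (norm (y - x))\<^sup>2"
    and D: "\<And>z. GDERIV (\<lambda>x. f x z) x :> G x z"
  shows "integrable M (G x)" "GDERIV (\<lambda>x. LINT z|M. f x z) x :> (LINT z|M. G x z)"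
proof -
  interpret finite_measure M by fact
  define c where "c x z = L / 2 * (norm x)\<^sup>2 - f x z" for x z
  have c: "integrable M (c x)" "convex_on UNIV (\<lambda>x. c x z)" for x z
    unfolding c_def using int convex_on_semiconcave[OF semi] by auto
  have sq: "GDERIV (\<lambda>x. L / 2 * (norm x)\<^sup>2) x :> L *\<^sub>R x"
    unfolding gderiv_def power2_norm_eq_inner
    by (auto intro!: derivative_eq_intros simp: inner_commute)
  have cD: "GDERIV (\<lambda>x. c x z) x :> L *\<^sub>R x - G x z" for z
    unfolding c_def by (intro GDERIV_diff sq D)
  have "integrable M (\<lambda>z. L *\<^sub>R x - (L *\<^sub>R x - G x z))"
    by (intro Bochner_Integration.integrable_diff integrable_gderiv_convex[OF c cD]) auto
  then show G: "integrable M (G x)" by simp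
  \<comment> \<open>The total mass is the factor produced by integrating the quadratic over
    \<open>z\<close>.\<close>
  have "GDERIV (\<lambda>x. measure M (space M) * (L / 2 * (norm x)\<^sup>2) - (LINT z|M. c x z)) x
      :> measure M (space M) *\<^sub>R (L *\<^sub>R x) - (LINT z|M. L *\<^sub>R x - G x z)"
    using gderiv_integral_convex[OF c cD] sq
    by (intro GDERIV_diff) (auto simp: gderiv_def inner_commute intro!: derivative_eq_intros)
  moreover have "measure M (space M) *\<^sub>R (L *\<^sub>R x) - (LINT z|M. L *\<^sub>R x - G x z) = (LINT z|M. G x z)"
    using G by simp
  moreover have "measure M (space M) * (L / 2 * (norm x)\<^sup>2) - (LINT z|M. c x z) = (LINT z|M. f x z)" for x
    unfolding c_def using int by simp
  ultimately show "GDERIV (\<lambda>x. LINT z|M. f x z) x :> (LINT z|M. G x z)" by simp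
qed

section \<open>Stability of minimizers and Danskin's formula\<close>

text \<open>On a small sphere around the unique minimizer of the limit function, convergence is uniform
  and the limit function is bounded away from its minimum; convexity then confines the nearby
  minimizers to the ball.\<close>

lemma tendsto_convex_minimizer:
  fixes F :: "'t \<Rightarrow> 'a::euclidean_space \<Rightarrow> real"
  assumes conv: "\<And>t. convex_on UNIV (F t)"
    and min: "\<And>t y. F t (m t) \<le> F t y"
    and cont: "continuous_on UNIV F0"
    and strict: "\<And>y. y \<noteq> y0 \<Longrightarrow> F0 y0 < F0 y"
    and unif: "\<And>r. uniform_limit (cball y0 r) F F0 net"
  shows "(m \<longlongrightarrow> y0) net"
proof (rule tendstoI)
  fix e :: real assume e: "e > 0"
  define r where "r = e / 2"
  have r: "0 < r" "r < e" using e by (auto simp: r_def)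
  have "\<exists>u\<in>sphere y0 r. \<forall>w\<in>sphere y0 r. F0 u \<le> F0 w"
    using r by (intro continuous_attains_inf) (auto intro: continuous_on_subset[OF cont])
  then obtain u where u: "u \<in> sphere y0 r" "\<And>w. w \<in> sphere y0 r \<Longrightarrow> F0 u \<le> F0 w"
    by blast
  \<comment> \<open>Half the gap: an error below \<open>\<delta>\<close> at each of two points
    cannot close it.\<close>
  define \<delta> where "\<delta> = (F0 u - F0 y0) / 2"
  have \<delta>: "0 < \<delta>"
    using strict[of u] u(1) r by (auto simp: \<delta>_def)
  have "\<forall>\<^sub>F t in net. \<forall>y\<in>cball y0 r. dist (F t y) (F0 y) < \<delta>"
    using uniform_limitD[OF unif \<delta>] .
  then show "\<forall>\<^sub>F t in net. dist (m t) y0 < e"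
  proof eventually_elim
    case (elim t)
    show ?case
    proof (rule ccontr)
      assume "\<not> ?thesis"
      then have far: "r < norm (m t - y0)" "0 < norm (m t - y0)"
        using r by (simp_all add: dist_norm del: zero_less_norm_iff)
      define s where "s = r / norm (m t - y0)"
      have s: "0 < s" "s < 1" using far r by (simp_all add: s_def del: zero_less_norm_iff)
      \<comment> \<open>The point where the segment from \<open>y0\<close> to \<open>m t\<close>
        crosses the sphere.\<close>
      define w where "w = (1 - s) *\<^sub>R y0 + s *\<^sub>R m t"
      have "w - y0 = s *\<^sub>R (m t - y0)" by (simp add: w_def algebra_simps)
      then have "norm (w - y0) = r" using far r by (simp add: s_def)
      then have w: "w \<in> sphere y0 r" by (simp add: dist_norm norm_minus_commute)
      have "F t w \<le> (1 - s) * F t y0 + s * F t (m t)"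
        unfolding w_def using s by (intro convex_onD[OF conv]) auto
      also have "\<dots> \<le> (1 - s) * F t y0 + s * F t y0"
        using s min by (intro add_left_mono mult_left_mono) auto
      finally have "F t w \<le> F t y0" by (simp add: algebra_simps)
      moreover have "dist (F t w) (F0 w) < \<delta>" "dist (F t y0) (F0 y0) < \<delta>"
        using elim w r by auto
      ultimately have "F0 w < F0 y0 + 2 * \<delta>"
        by (simp add: dist_real_def abs_less_iff)
      then show False using u(2)[OF w] by (simp add: \<delta>_def field_simps)
    qed
  qed
qed

text \<open>Since \<open>L\<close> is the same for all \<open>y\<close>, the difference quotients in
  \<open>\<theta>\<close> converge uniformly in \<open>y\<close>, and each of them is
  continuous.\<close>

lemma continuous_partial_gradient:
  fixes g :: "'a::euclidean_space \<Rightarrow> 'b::t2_space \<Rightarrow> real"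
  assumes cont: "\<And>\<theta>. continuous_on UNIV (g \<theta>)"
    and taylor: "\<And>\<theta> \<theta>' y. \<bar>g \<theta>' y - g \<theta> y - inner (\<theta>' - \<theta>) (D \<theta> y)\<bar> \<le> L / 2 * (norm (\<theta>' - \<theta>))\<^sup>2"
  shows "continuous_on UNIV (D \<theta>)"
proof -
  have "continuous_on UNIV (\<lambda>y. inner (D \<theta> y) b)" if b: "b \<in> Basis" for b
  proof (rule uniform_limit_theorem)
    show "\<forall>\<^sub>F t in at_right (0::real).
        continuous_on UNIV (\<lambda>y. (g (\<theta> + t *\<^sub>R b) y - g \<theta> y) * inverse t)"
      by (intro always_eventually allI continuous_intros cont)
    have "((\<lambda>t. L / 2 * t) \<longlongrightarrow> L / 2 * 0) (at_right 0)"
      by (intro tendsto_intros)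
    then have lim: "((\<lambda>t. L / 2 * t) \<longlongrightarrow> 0) (at_right 0)" by simp
    show "uniform_limit UNIV (\<lambda>t y. (g (\<theta> + t *\<^sub>R b) y - g \<theta> y) * inverse t)
        (\<lambda>y. inner (D \<theta> y) b) (at_right 0)"
    proof (rule uniform_limitI)
      fix e :: real assume "e > 0"
      then have "\<forall>\<^sub>F t in at_right 0. L / 2 * t < e"
        using lim by (intro order_tendstoD)
      then show "\<forall>\<^sub>F t in at_right 0. \<forall>y\<in>UNIV.
          dist ((g (\<theta> + t *\<^sub>R b) y - g \<theta> y) * inverse t) (inner (D \<theta> y) b) < e"
        using eventually_at_right_less
      proof eventually_elim
        case (elim t)
        show ?case
        proof
          fix y
          have quot: "(g (\<theta> + t *\<^sub>R b) y - g \<theta> y) * inverse t - inner (D \<theta> y) b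
              = (g (\<theta> + t *\<^sub>R b) y - g \<theta> y - t * inner b (D \<theta> y)) / t"
            using elim by (simp add: field_simps inner_commute)
          have "\<bar>g (\<theta> + t *\<^sub>R b) y - g \<theta> y - t * inner b (D \<theta> y)\<bar> \<le> L / 2 * t\<^sup>2"
            using taylor[where \<theta>=\<theta> and \<theta>'="\<theta> + t *\<^sub>R b" and y=y] b by simp
          then have "\<bar>g (\<theta> + t *\<^sub>R b) y - g \<theta> y - t * inner b (D \<theta> y)\<bar> / t \<le> L / 2 * t\<^sup>2 / t"
            using elim by (intro divide_right_mono) auto
          moreover have "L / 2 * t\<^sup>2 / t = L / 2 * t"
            using elim by (simp add: power2_eq_square)
          ultimately have "\<bar>g (\<theta> + t *\<^sub>R b) y - g \<theta> y - t * inner b (D \<theta> y)\<bar> / t < e"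
            using elim by simp
          with quot show "dist ((g (\<theta> + t *\<^sub>R b) y - g \<theta> y) * inverse t) (inner (D \<theta> y) b) < e"
            using elim by (simp only: dist_real_def abs_divide abs_of_pos)
        qed
      qed
    qed
  qed simp
  then show ?thesis
    by (subst continuous_on_componentwise) blast
qed

text \<open>Each minimizer is a competitor in the other's problem, so to first order the motion of
  the minimizer does not contribute.\<close>

lemma gderiv_min_value:
  fixes g :: "'a::euclidean_space \<Rightarrow> 'b::euclidean_space \<Rightarrow> real"
  assumes cont: "\<And>\<theta>. continuous_on UNIV (g \<theta>)" "continuous_on UNIV \<phi>"
    and taylor: "\<And>\<theta> \<theta>' y. \<bar>g \<theta>' y - g \<theta> y - inner (\<theta>' - \<theta>) (D \<theta> y)\<bar> \<le> L / 2 * (norm (\<theta>' - \<theta>))\<^sup>2"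
    and conv: "\<And>\<theta>. convex_on UNIV (\<lambda>y. \<phi> y + g \<theta> y)"
    and strict: "\<And>\<theta> y. y \<noteq> m \<theta> \<Longrightarrow> \<phi> (m \<theta>) + g \<theta> (m \<theta>) < \<phi> y + g \<theta> y"
  shows "GDERIV (\<lambda>\<theta>. \<phi> (m \<theta>) + g \<theta> (m \<theta>)) \<theta> :> D \<theta> (m \<theta>)"
proof -
  have min: "\<phi> (m \<theta>) + g \<theta> (m \<theta>) \<le> \<phi> y + g \<theta> y" for \<theta> y
    using strict[of y \<theta>] by (cases "y = m \<theta>") auto
  have contD: "continuous_on UNIV (D \<theta>)"
    using cont(1) taylor by (rule continuous_partial_gradient)
  \<comment> \<open>On a compact ball the continuous \<open>D \<theta>\<close> is bounded, which
    makes the Taylor estimate uniform there.\<close>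
  have "uniform_limit (cball (m \<theta>) r) (\<lambda>h y. \<phi> y + g (\<theta> + h) y) (\<lambda>y. \<phi> y + g \<theta> y) (at 0)" for r
  proof (rule uniform_limitI)
    fix e :: real assume e: "e > 0"
    have "bounded (D \<theta> ` cball (m \<theta>) r)"
      by (intro compact_imp_bounded compact_continuous_image continuous_on_subset[OF contD]) auto
    then obtain B where B: "\<And>y. y \<in> cball (m \<theta>) r \<Longrightarrow> norm (D \<theta> y) \<le> B"
      unfolding bounded_iff by blast
    have "((\<lambda>h::'a. norm h * B + L / 2 * (norm h)\<^sup>2) \<longlongrightarrow> norm (0::'a) * B + L / 2 * (norm (0::'a))\<^sup>2) (at 0)"
      by (intro tendsto_intros tendsto_norm[OF tendsto_ident_at])
    then have "\<forall>\<^sub>F h::'a in at 0. norm h * B + L / 2 * (norm h)\<^sup>2 < e"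
      using e by (intro order_tendstoD) auto
    then show "\<forall>\<^sub>F h in at 0. \<forall>y\<in>cball (m \<theta>) r. dist (\<phi> y + g (\<theta> + h) y) (\<phi> y + g \<theta> y) < e"
    proof eventually_elim
      case (elim h)
      show ?case
      proof
        fix y assume y: "y \<in> cball (m \<theta>) r"
        have "\<bar>inner h (D \<theta> y)\<bar> \<le> norm h * norm (D \<theta> y)"
          by (rule Cauchy_Schwarz_ineq2)
        also have "\<dots> \<le> norm h * B"
          using B[OF y] by (intro mult_left_mono) auto
        finally show "dist (\<phi> y + g (\<theta> + h) y) (\<phi> y + g \<theta> y) < e"
          using taylor[where \<theta>=\<theta> and \<theta>'="\<theta> + h" and y=y] elim
          by (simp add: dist_real_def abs_if split: if_splits)
      qed
    qed
  qed
  then have "((\<lambda>h. m (\<theta> + h)) \<longlongrightarrow> m \<theta>) (at 0)"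
    using conv min strict
    by (intro tendsto_convex_minimizer[where F="\<lambda>h y. \<phi> y + g (\<theta> + h) y"
          and ?F0.0="\<lambda>y. \<phi> y + g \<theta> y"] continuous_on_add cont) auto
  moreover have "isCont (D \<theta>) (m \<theta>)"
    using contD by (simp add: continuous_on_eq_continuous_at)
  ultimately have "((\<lambda>h. D \<theta> (m (\<theta> + h))) \<longlongrightarrow> D \<theta> (m \<theta>)) (at 0)"
    by (rule isCont_tendsto_compose[rotated])
  then have "((\<lambda>h. norm (D \<theta> (m (\<theta> + h)) - D \<theta> (m \<theta>)) + L / 2 * norm h)
      \<longlongrightarrow> norm (D \<theta> (m \<theta>) - D \<theta> (m \<theta>)) + L / 2 * norm (0::'a)) (at 0)"
    by (intro tendsto_intros tendsto_norm[OF tendsto_ident_at])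
  then have lim: "((\<lambda>h. norm (D \<theta> (m (\<theta> + h)) - D \<theta> (m \<theta>)) + L / 2 * norm h) \<longlongrightarrow> 0) (at 0)"
    by simp
  define R where "R h = \<phi> (m (\<theta> + h)) + g (\<theta> + h) (m (\<theta> + h)) - (\<phi> (m \<theta>) + g \<theta> (m \<theta>))
      - inner h (D \<theta> (m \<theta>))" for h
  \<comment> \<open>Testing the old minimizer at the new parameter bounds \<open>R h\<close> above;
    testing the new minimizer at the old parameter bounds it below, at the cost of the change in
    \<open>D \<theta>\<close>.\<close>
  have R: "\<bar>R h\<bar> \<le> norm h * norm (D \<theta> (m (\<theta> + h)) - D \<theta> (m \<theta>)) + L / 2 * (norm h)\<^sup>2" for h
  proof -
    have "\<bar>inner h (D \<theta> (m (\<theta> + h)) - D \<theta> (m \<theta>))\<bar> \<le> norm h * norm (D \<theta> (m (\<theta> + h)) - D \<theta> (m \<theta>))"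
      by (rule Cauchy_Schwarz_ineq2)
    moreover have "R h \<le> L / 2 * (norm h)\<^sup>2"
      using min[of "\<theta> + h" "m \<theta>"] taylor[where \<theta>=\<theta> and \<theta>'="\<theta> + h" and y="m \<theta>", THEN abs_le_D1]
      by (simp add: R_def)
    moreover have "inner h (D \<theta> (m (\<theta> + h)) - D \<theta> (m \<theta>)) - L / 2 * (norm h)\<^sup>2 \<le> R h"
      using min[of \<theta> "m (\<theta> + h)"] taylor[where \<theta>=\<theta> and \<theta>'="\<theta> + h" and y="m (\<theta> + h)", THEN abs_le_D2]
      by (simp add: R_def inner_diff_right)
    moreover have "0 \<le> norm h * norm (D \<theta> (m (\<theta> + h)) - D \<theta> (m \<theta>))" by simp
    ultimately show ?thesis by linarith
  qed
  have "((\<lambda>h. norm (R h) / norm h) \<longlongrightarrow> 0) (at 0)"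
  proof (rule Lim_null_comparison[OF _ lim])
    show "\<forall>\<^sub>F h in at 0. norm (norm (R h) / norm h)
        \<le> norm (D \<theta> (m (\<theta> + h)) - D \<theta> (m \<theta>)) + L / 2 * norm h"
      \<comment> \<open>This supplies \<open>h \<noteq> 0\<close> for the division by
        \<open>norm h\<close>; the radius 1 is arbitrary.\<close>
      using eventually_at_ball'[of 1 0 UNIV]
    proof (rule eventually_mono)
      show "norm (norm (R h) / norm h) \<le> norm (D \<theta> (m (\<theta> + h)) - D \<theta> (m \<theta>)) + L / 2 * norm h"
        if "h \<in> ball 0 1 \<and> h \<noteq> 0 \<and> h \<in> UNIV" for h
        using R[of h] that by (simp add: pos_divide_le_eq power2_eq_square algebra_simps)
    qed simp
  qed
  then show ?thesis
    unfolding gderiv_def has_derivative_at R_def by (simp add: bounded_linear_inner_left)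
qed

section \<open>The proximal problem and the gradient of the loss\<close>

text \<open>The proximal quadratic can give up \<open>\<gamma> / 2 * (norm y)\<^sup>2\<close> to
  convexify \<open>f\<close> and stay convex, because the remaining curvature
  \<open>1 - \<gamma>\<close> is nonnegative.\<close>

lemma convex_on_prox_objective:
  fixes f :: "'a::real_inner \<Rightarrow> real"
  assumes "weakly_convex \<gamma> f" and "\<gamma> \<le> 1"
  shows "convex_on UNIV (prox_objective f z)"
proof -
  have "convex_on UNIV (\<lambda>y. 1 / 2 * (norm (y - z))\<^sup>2 - \<gamma> / 2 * (norm y)\<^sup>2)"
  proof (rule convex_on_of_subgradient[where v="\<lambda>y. (y - z) - \<gamma> *\<^sub>R y"])
    fix x y :: 'a
    define h where "h = y - x"
    have y: "y = x + h" by (simp add: h_def)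
    have z: "x + h - z = (x - z) + h" by simp
    have "0 \<le> (1 - \<gamma>) * (norm h)\<^sup>2" using assms by simp
    then show "1 / 2 * (norm (x - z))\<^sup>2 - \<gamma> / 2 * (norm x)\<^sup>2 + inner (y - x) (x - z - \<gamma> *\<^sub>R x)
        \<le> 1 / 2 * (norm (y - z))\<^sup>2 - \<gamma> / 2 * (norm y)\<^sup>2"
      unfolding y z norm_sq_expand by (simp add: inner_diff_right algebra_simps)
  qed
  then have "convex_on UNIV (\<lambda>y. (1 / 2 * (norm (y - z))\<^sup>2 - \<gamma> / 2 * (norm y)\<^sup>2)
      + (f y + \<gamma> / 2 * (norm y)\<^sup>2))"
    using assms(1) unfolding weakly_convex_def by (rule convex_on_add)
  then show ?thesis by (simp add: prox_objective_def[abs_def])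
qed

theorem lemma3p2:
  fixes \<mu> \<nu> :: "(real ^ 'd) measure"
    and g :: "real ^ 'p \<Rightarrow> real ^ 'd \<Rightarrow> real"
    and ystar :: "real ^ 'p \<Rightarrow> real ^ 'd \<Rightarrow> real ^ 'd"
    and \<gamma> L :: real
  assumes "prob_finite_second_moment \<mu>"
    and "prob_finite_second_moment \<nu>"
    and "0 < \<gamma>" and "\<gamma> < 1"
    and "\<And>\<theta>. weakly_convex \<gamma> (g \<theta>)"
    and "\<And>\<theta>. cont_differentiable (g \<theta>)"
    and "\<And>y. smooth_fun L (\<lambda>\<theta>. g \<theta> y)"
    and "\<And>\<theta> z. unique_minimizer (prox_objective (g \<theta>) z) (ystar \<theta> z)"
    and "\<And>\<theta>. integrable \<mu> (g \<theta>)"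
    and "\<And>\<theta>. integrable \<nu> (\<lambda>z. prox_objective (g \<theta>) z (ystar \<theta> z))"
  shows "\<forall>\<theta>.
      integrable \<mu> (\<lambda>x. gradient (\<lambda>\<theta>'. g \<theta>' x) \<theta>) \<and>
      integrable \<nu> (\<lambda>z. gradient (\<lambda>\<theta>'. g \<theta>' (ystar \<theta> z)) \<theta>) \<and>
      (GDERIV (loss \<mu> \<nu> g ystar) \<theta> :>
         (LINT x|\<mu>. gradient (\<lambda>\<theta>'. g \<theta>' x) \<theta>)
         - (LINT z|\<nu>. gradient (\<lambda>\<theta>'. g \<theta>' (ystar \<theta> z)) \<theta>))"
proof
  fix \<theta>
  note prob = assms(1,2) and wc = assms(5) and cd = assms(6) and smooth = assms(7)
    and argmin = assms(8) and int = assms(9,10)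
  interpret \<mu>: prob_space \<mu> using prob(1) by (simp add: prob_finite_second_moment_def)
  interpret \<nu>: prob_space \<nu> using prob(2) by (simp add: prob_finite_second_moment_def)
  \<comment> \<open>The argument \<open>y\<close> is frozen before differentiating, so
    \<open>D \<theta> (ystar \<theta> z)\<close> ignores the dependence of \<open>ystar\<close> on
    the parameter.\<close>
  define D where "D \<theta> y = gradient (\<lambda>\<theta>. g \<theta> y) \<theta>" for \<theta> y
  define V where "V \<theta> z = prox_objective (g \<theta>) z (ystar \<theta> z)" for \<theta> z
  have taylor: "\<bar>g \<theta>' y - g \<theta> y - inner (\<theta>' - \<theta>) (D \<theta> y)\<bar> \<le> L / 2 * (norm (\<theta>' - \<theta>))\<^sup>2" for \<theta> \<theta>' y
    unfolding D_def using smooth by (rule smooth_fun_taylor)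
  have gD: "GDERIV (\<lambda>\<theta>. g \<theta> y) \<theta> :> D \<theta> y" for y
    unfolding D_def using smooth by (rule smooth_fun_gderiv)
  have cont: "continuous_on UNIV (g \<theta>)" for \<theta>
    using cd[of \<theta>] by (auto simp: cont_differentiable_def intro: differentiable_imp_continuous_on)
  have min: "V \<theta> z \<le> prox_objective (g \<theta>) z y" for \<theta> z y
    using argmin[of \<theta> z] by (auto simp: V_def unique_minimizer_def is_arg_min_linorder)
  have strict: "V \<theta> z < prox_objective (g \<theta>) z y" if "y \<noteq> ystar \<theta> z" for \<theta> z y
  proof (rule ccontr)
    assume "\<not> V \<theta> z < prox_objective (g \<theta>) z y"
    then have "prox_objective (g \<theta>) z y \<le> prox_objective (g \<theta>) z y'" for y'
      using min[of \<theta> z y'] by linarith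
    then have "is_arg_min (prox_objective (g \<theta>) z) (\<lambda>_. True) y"
      by (simp add: is_arg_min_linorder)
    then show False using argmin[of \<theta> z] that by (auto simp: unique_minimizer_def)
  qed
  have VD: "GDERIV (\<lambda>\<theta>. V \<theta> z) \<theta> :> D \<theta> (ystar \<theta> z)" for z
    unfolding V_def prox_objective_def
  proof (rule gderiv_min_value[where m="\<lambda>\<theta>. ystar \<theta> z" and L=L, OF cont _ taylor])
    show "convex_on UNIV (\<lambda>y. 1 / 2 * (norm (y - z))\<^sup>2 + g \<theta> y)" for \<theta>
      using convex_on_prox_objective[OF wc, of \<theta> z] \<open>\<gamma> < 1\<close> by (simp add: prox_objective_def[abs_def])
    show "1 / 2 * (norm (ystar \<theta> z - z))\<^sup>2 + g \<theta> (ystar \<theta> z) < 1 / 2 * (norm (y - z))\<^sup>2 + g \<theta> y"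
      if "y \<noteq> ystar \<theta> z" for \<theta> y
      using strict[OF that] by (simp add: V_def prox_objective_def)
  qed (intro continuous_intros)
  \<comment> \<open>Only the upper Taylor bound passes to a minimum: the old minimizer is tested at
    the new parameter.\<close>
  have Vsemi: "V \<theta>' z - V \<theta> z - inner (\<theta>' - \<theta>) (D \<theta> (ystar \<theta> z)) \<le> L / 2 * (norm (\<theta>' - \<theta>))\<^sup>2" for \<theta> \<theta>' z
    using min[of \<theta>' z "ystar \<theta> z"] taylor[of \<theta>' "ystar \<theta> z" \<theta>, THEN abs_le_D1]
    by (simp add: V_def prox_objective_def)
  have gsemi: "g \<theta>' y - g \<theta> y - inner (\<theta>' - \<theta>) (D \<theta> y) \<le> L / 2 * (norm (\<theta>' - \<theta>))\<^sup>2" for \<theta> \<theta>' y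
    using taylor[of \<theta>' y \<theta>] by (rule abs_le_D1)
  have Vint: "integrable \<nu> (V \<theta>)" for \<theta>
    using int(2)[of \<theta>] by (simp add: V_def[abs_def])
  note first = gderiv_integral_semiconcave[OF \<mu>.finite_measure_axioms int(1) gsemi gD]
    and second = gderiv_integral_semiconcave[where G="\<lambda>\<theta> z. D \<theta> (ystar \<theta> z)",
      OF \<nu>.finite_measure_axioms Vint Vsemi VD]
  have "loss \<mu> \<nu> g ystar = (\<lambda>\<theta>. (LINT x|\<mu>. g \<theta> x) - (LINT z|\<nu>. V \<theta> z))"
    by (simp add: fun_eq_iff loss_def V_def)
  then have "GDERIV (loss \<mu> \<nu> g ystar) \<theta> :>
      (LINT x|\<mu>. D \<theta> x) - (LINT z|\<nu>. D \<theta> (ystar \<theta> z))"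
    using first(2) second(2) by (simp add: GDERIV_diff)
  with first(1) second(1)
  show "integrable \<mu> (\<lambda>x. gradient (\<lambda>\<theta>'. g \<theta>' x) \<theta>) \<and>
      integrable \<nu> (\<lambda>z. gradient (\<lambda>\<theta>'. g \<theta>' (ystar \<theta> z)) \<theta>) \<and>
      (GDERIV (loss \<mu> \<nu> g ystar) \<theta> :>
         (LINT x|\<mu>. gradient (\<lambda>\<theta>'. g \<theta>' x) \<theta>)
         - (LINT z|\<nu>. gradient (\<lambda>\<theta>'. g \<theta>' (ystar \<theta> z)) \<theta>))"
    unfolding D_def by blast
qed

end
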